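(* Let $B\ge 2$ and $D=1+i$. For every positive integer $m$ there exists a $D$-consecutive sequence of $m$ Gaussian $B$-happy numbers.
   Context: Fix an integer $B\ge 2$. Every nonzero Gaussian integer $a+bi$ is written uniquely as $a+bi=\sum_{j=0}^n (a_j+b_ji)B^j$ with $a_j,b_j\in\mathbb{Z}$, $a_n,b_n$ not both $0$, and for each $j$: $|a_j|\le B-1$, $|b_j|\le B-1$, $\operatorname{sgn}(a)a_j\ge 0$, $\operatorname{sgn}(b)b_j\ge 0$. The Gaussian $B$-happy function $S_B:\mathbb{Z}[i]\to\mathbb{Z}[i]$ is defined by $S_B(0)=0$ and $S_B(a+bi)=\sum_{j=0}^n (a_j+b_ji)^2$. A Gaussian integer $z$ is Gaussian $B$-happy if $S_B^k(z)=1$ for some $k\ge1$. For $D\in\mathbb{Z}[i]\setminus\{0\}$, a $D$-consecutive sequence of length $m$ is a sequence $z,z+D,\dots,z+(m-1)D$ with $z\in\mathbb{Z}[i]$. *)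

theory Defs
  imports Complex_Main
begin

definition gauss_ints :: "complex set" where
  "gauss_ints = {z. Re z \<in> \<int> \<and> Im z \<in> \<int>}"

definition gauss_expansion ::
    "int \<Rightarrow> complex \<Rightarrow> nat \<Rightarrow> (nat \<Rightarrow> int) \<Rightarrow> (nat \<Rightarrow> int) \<Rightarrow> bool" where
  "gauss_expansion B z n a b \<longleftrightarrow>
     z = (\<Sum>j\<le>n. (of_int (a j) + of_int (b j) * \<i>) * of_int B ^ j) \<and>
     (a n \<noteq> 0 \<or> b n \<noteq> 0) \<and>
     (\<forall>j\<le>n. \<bar>a j\<bar> \<le> B - 1 \<and> \<bar>b j\<bar> \<le> B - 1 \<and>
            sgn (Re z) * of_int (a j) \<ge> 0 \<and> sgn (Im z) * of_int (b j) \<ge> 0)"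

text \<open>Only meaningful for \<open>B \<ge> 2\<close> and \<open>z \<in> gauss_ints\<close>, where the expansion exists and its
  digits up to \<open>n\<close> are unique (see \<open>gauss_expansion_exists\<close>, \<open>gauss_expansion_unique\<close>,
  \<open>gauss_happy_fun_eq\<close> below).\<close>

definition gauss_happy_fun :: "int \<Rightarrow> complex \<Rightarrow> complex" where
  "gauss_happy_fun B z =
     (if z = 0 then 0
      else THE s. \<exists>n a b. gauss_expansion B z n a b \<and>
                         s = (\<Sum>j\<le>n. (of_int (a j) + of_int (b j) * \<i>)\<^sup>2))"

definition gauss_happy :: "int \<Rightarrow> complex \<Rightarrow> bool" where
  "gauss_happy B z \<longleftrightarrow> z \<in> gauss_ints \<and> (\<exists>k\<ge>1. (gauss_happy_fun B ^^ k) z = 1)"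

definition consecutive_seq :: "complex \<Rightarrow> nat \<Rightarrow> complex list \<Rightarrow> bool" where
  "consecutive_seq D m zs \<longleftrightarrow> D \<in> gauss_ints \<and> D \<noteq> 0 \<and>
     (\<exists>z\<in>gauss_ints. zs = map (\<lambda>k. z + of_nat k * D) [0..<m])"


lemma digits_zero:
  fixes c :: "nat \<Rightarrow> int"
  assumes "\<forall>j<N. \<bar>c j\<bar> \<le> B - 1" "(\<Sum>j<N. c j * B ^ j) = 0" "B \<ge> 2"
  shows "\<forall>j<N. c j = 0"
  using assms
proof (induction N arbitrary: c)
  case 0
  then show ?case by simp
next
  case (Suc N)
  have eq: "c 0 + B * (\<Sum>j<N. c (Suc j) * B ^ j) = 0"
    using Suc.prems(2) by (simp add: sum.lessThan_Suc_shift sum_distrib_left mult.left_commute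
        del: sum.lessThan_Suc)
  then have "B dvd c 0" by (metis add.commute dvd_add_right_iff dvd_triv_left dvd_0_right)
  then have c0: "c 0 = 0"
    using Suc.prems(1,3) zdvd_not_zless[of "\<bar>c 0\<bar>" B] by force
  then have "(\<Sum>j<N. c (Suc j) * B ^ j) = 0" using eq Suc.prems(3) by simp
  moreover have "\<forall>j<N. \<bar>c (Suc j)\<bar> \<le> B - 1" using Suc.prems(1) by blast
  ultimately have "\<forall>j<N. c (Suc j) = 0"
    using Suc.IH[of "\<lambda>j. c (Suc j)"] Suc.prems(3) by blast
  then show ?case using c0 by (metis less_Suc_eq_0_disj)
qed

lemma digits_unique:
  fixes c c' :: "nat \<Rightarrow> int"
  assumes c: "\<forall>j<N. \<bar>c j\<bar> \<le> B - 1 \<and> sgn x * c j \<ge> 0" "(\<Sum>j<N. c j * B ^ j) = x"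
    and c': "\<forall>j<N. \<bar>c' j\<bar> \<le> B - 1 \<and> sgn x * c' j \<ge> 0" "(\<Sum>j<N. c' j * B ^ j) = x"
    and "B \<ge> 2"
  shows "\<forall>j<N. c j = c' j"
proof (cases "x = 0")
  case True
  have "\<forall>j<N. c j = 0"
    by (rule digits_zero[of N c B]) (use c True \<open>B \<ge> 2\<close> in blast)+
  moreover have "\<forall>j<N. c' j = 0"
    by (rule digits_zero[of N c' B]) (use c' True \<open>B \<ge> 2\<close> in blast)+
  ultimately show ?thesis by metis
next
  case False
  have "\<forall>j<N. c j - c' j = 0"
  proof (rule digits_zero)
    show "(\<Sum>j<N. (c j - c' j) * B ^ j) = 0"
      unfolding left_diff_distrib sum_subtractf c(2) c'(2) by (rule diff_self)
    show "\<forall>j<N. \<bar>c j - c' j\<bar> \<le> B - 1"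
    proof (intro allI impI)
      fix j assume "j < N"
      then have "\<bar>c j\<bar> \<le> B - 1" "\<bar>c' j\<bar> \<le> B - 1" "sgn x * c j \<ge> 0" "sgn x * c' j \<ge> 0"
        using c(1) c'(1) by blast+
      moreover have "sgn x = 1 \<or> sgn x = - 1" using False by (simp add: sgn_if)
      ultimately show "\<bar>c j - c' j\<bar> \<le> B - 1" by auto
    qed
  qed (fact \<open>B \<ge> 2\<close>)
  then show ?thesis by simp
qed

lemma digits_exist:
  fixes x B :: int
  assumes "B \<ge> 2"
  shows "\<exists>N0. \<forall>N\<ge>N0. (\<Sum>j<N. sgn x * (\<bar>x\<bar> div B ^ j mod B) * B ^ j) = x"
proof -
  have step: "(\<Sum>j<N. (y div B ^ j mod B) * B ^ j) + (y div B ^ N) * B ^ N = y" for N y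
  proof (induction N)
    case 0
    then show ?case by simp
  next
    case (Suc N)
    have "y div B ^ Suc N = y div B ^ N div B"
      using assms zdiv_zmult2_eq[of B y "B ^ N"] by (simp add: mult.commute)
    then have "y div B ^ N = B * (y div B ^ Suc N) + y div B ^ N mod B"
      by simp
    then have "(y div B ^ N) * B ^ N = (y div B ^ Suc N) * B ^ Suc N + (y div B ^ N mod B) * B ^ N"
      by (metis add.commute distrib_right mult.assoc mult.commute power_Suc)
    then show ?case using Suc.IH by simp
  qed
  have "(\<Sum>j<N. sgn x * (\<bar>x\<bar> div B ^ j mod B) * B ^ j) = x" if "N \<ge> nat \<bar>x\<bar>" for N
  proof -
    have "\<bar>x\<bar> \<le> int N" using that by simp
    also have "\<dots> < 2 ^ N" by (rule of_nat_less_two_power)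
    also have "\<dots> \<le> B ^ N" using assms by (intro power_mono) auto
    finally have "\<bar>x\<bar> div B ^ N = 0" by simp
    then have "(\<Sum>j<N. (\<bar>x\<bar> div B ^ j mod B) * B ^ j) = \<bar>x\<bar>" using step[of "\<bar>x\<bar>" N] by simp
    then have "sgn x * (\<Sum>j<N. (\<bar>x\<bar> div B ^ j mod B) * B ^ j) = x"
      by (simp add: mult_sgn_abs)
    then show ?thesis by (simp add: sum_distrib_left mult.assoc)
  qed
  then show ?thesis by blast
qed

lemma gauss_sum_parts:
  "(\<Sum>j\<in>A. (of_int (a j) + of_int (b j) * \<i>) * of_int B ^ j) =
   Complex (of_int (\<Sum>j\<in>A. a j * B ^ j)) (of_int (\<Sum>j\<in>A. b j * B ^ j))"
proof -
  have "(of_int (a j) + of_int (b j) * \<i>) * of_int B ^ j =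
        of_int (a j * B ^ j) + \<i> * of_int (b j * B ^ j)" for j
    by (simp add: algebra_simps)
  then have "(\<Sum>j\<in>A. (of_int (a j) + of_int (b j) * \<i>) * of_int B ^ j) =
        of_int (\<Sum>j\<in>A. a j * B ^ j) + \<i> * of_int (\<Sum>j\<in>A. b j * B ^ j)"
    by (simp only: sum.distrib of_int_sum sum_distrib_left)
  also have "\<dots> = Complex (of_int (\<Sum>j\<in>A. a j * B ^ j)) (of_int (\<Sum>j\<in>A. b j * B ^ j))"
    by (simp only: complex_eq_iff) simp
  finally show ?thesis .
qed

lemma gauss_expansion_int_iff:
  "gauss_expansion B (Complex (of_int x) (of_int y)) n a b \<longleftrightarrow>
     (\<Sum>j\<le>n. a j * B ^ j) = x \<and> (\<Sum>j\<le>n. b j * B ^ j) = y \<and> (a n \<noteq> 0 \<or> b n \<noteq> 0) \<and>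
     (\<forall>j\<le>n. \<bar>a j\<bar> \<le> B - 1 \<and> \<bar>b j\<bar> \<le> B - 1 \<and> sgn x * a j \<ge> 0 \<and> sgn y * b j \<ge> 0)"
proof -
  have sg: "sgn (of_int u :: real) * of_int v \<ge> 0 \<longleftrightarrow> sgn u * v \<ge> 0" for u v :: int
    by (simp add: sgn_if)
  show ?thesis
    unfolding gauss_expansion_def gauss_sum_parts complex.sel sg complex.inject of_int_eq_iff
    by auto
qed

lemma gauss_ints_cases:
  assumes "z \<in> gauss_ints"
  obtains x y where "z = Complex (of_int x) (of_int y)"
  using assms unfolding gauss_ints_def by (auto elim!: Ints_cases simp: complex_eq_iff)

lemma gauss_expansion_exists:
  assumes "B \<ge> 2" "z \<in> gauss_ints" "z \<noteq> 0"
  shows "\<exists>n a b. gauss_expansion B z n a b"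
proof -
  obtain x y where z: "z = Complex (of_int x) (of_int y)" using assms(2) by (rule gauss_ints_cases)
  define dig where "dig = (\<lambda>(x::int) j. sgn x * (\<bar>x\<bar> div B ^ j mod B))"
  obtain N1 where N1: "\<forall>N\<ge>N1. (\<Sum>j<N. dig x j * B ^ j) = x"
    using digits_exist[OF assms(1), of x] unfolding dig_def by blast
  obtain N2 where N2: "\<forall>N\<ge>N2. (\<Sum>j<N. dig y j * B ^ j) = y"
    using digits_exist[OF assms(1), of y] unfolding dig_def by blast
  define N where "N = max N1 N2"
  have sx: "(\<Sum>j<N. dig x j * B ^ j) = x" and sy: "(\<Sum>j<N. dig y j * B ^ j) = y"
    using N1 N2 by (auto simp: N_def)
  define J where "J = {j. j < N \<and> (dig x j \<noteq> 0 \<or> dig y j \<noteq> 0)}"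
  have fin: "finite J" by (simp add: J_def)
  have ne: "J \<noteq> {}"
  proof
    assume "J = {}"
    then have "\<forall>j<N. dig x j = 0 \<and> dig y j = 0" unfolding J_def by blast
    then have "x = 0" "y = 0" using sx sy by (auto simp: sum.neutral)
    then show False using assms(3) z by (simp add: complex_eq_iff)
  qed
  define n where "n = Max J"
  have nJ: "n \<in> J" using fin ne by (simp add: n_def)
  have top: "dig x j = 0 \<and> dig y j = 0" if "j < N" "n < j" for j
  proof (rule ccontr)
    assume "\<not> ?thesis"
    then have "j \<in> J" using that by (simp add: J_def)
    then show False using Max_ge[OF fin] that by (fastforce simp: n_def)
  qed
  have "(\<Sum>j\<le>n. dig x j * B ^ j) = (\<Sum>j<N. dig x j * B ^ j)"
    using nJ top by (intro sum.mono_neutral_left) (auto simp: J_def)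
  moreover have "(\<Sum>j\<le>n. dig y j * B ^ j) = (\<Sum>j<N. dig y j * B ^ j)"
    using nJ top by (intro sum.mono_neutral_left) (auto simp: J_def)
  moreover have "\<bar>dig u j\<bar> \<le> B - 1 \<and> sgn u * dig u j \<ge> 0" for u j
  proof -
    have "0 \<le> \<bar>u\<bar> div B ^ j mod B" "\<bar>u\<bar> div B ^ j mod B < B" using assms(1) by auto
    then show ?thesis using assms(1) by (auto simp: dig_def sgn_if)
  qed
  ultimately have "gauss_expansion B z n (dig x) (dig y)"
    using sx sy nJ unfolding z gauss_expansion_int_iff J_def by auto
  then show ?thesis by blast
qed

lemma gauss_expansion_unique:
  assumes B: "B \<ge> 2"
    and e: "gauss_expansion B z n a b" and e': "gauss_expansion B z n' a' b'"
  shows "n = n' \<and> (\<forall>j\<le>n. a j = a' j \<and> b j = b' j)"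
proof -
  obtain x y where z: "z = Complex (of_int x) (of_int y)"
    using e unfolding gauss_expansion_def gauss_sum_parts by blast
  note E = e[unfolded z gauss_expansion_int_iff] and E' = e'[unfolded z gauss_expansion_int_iff]
  define N where "N = Suc (max n n')"
  define ext where "ext = (\<lambda>(k::nat) (c::nat \<Rightarrow> int) j. if j \<le> k then c j else 0)"
  have ext_sum: "(\<Sum>j<N. ext k c j * B ^ j) = (\<Sum>j\<le>k. c j * B ^ j)" if "k < N" for k c
  proof -
    have "(\<Sum>j\<le>k. c j * B ^ j) = (\<Sum>j\<le>k. ext k c j * B ^ j)"
      by (rule sum.cong) (auto simp: ext_def)
    also have "\<dots> = (\<Sum>j<N. ext k c j * B ^ j)"
      using that by (intro sum.mono_neutral_left) (auto simp: ext_def)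
    finally show ?thesis by simp
  qed
  have ext_bd: "\<bar>ext k c j\<bar> \<le> B - 1 \<and> sgn u * ext k c j \<ge> 0"
    if "\<forall>j\<le>k. \<bar>c j\<bar> \<le> B - 1 \<and> sgn u * c j \<ge> 0" for k c u j
    using that B by (simp add: ext_def)
  have lt: "n < N" "n' < N" by (auto simp: N_def)
  have A: "\<forall>j<N. ext n a j = ext n' a' j"
  proof (rule digits_unique[where B = B and x = x])
    show "\<forall>j<N. \<bar>ext n a j\<bar> \<le> B - 1 \<and> sgn x * ext n a j \<ge> 0"
      using ext_bd[of n a x] E by blast
    show "\<forall>j<N. \<bar>ext n' a' j\<bar> \<le> B - 1 \<and> sgn x * ext n' a' j \<ge> 0"
      using ext_bd[of n' a' x] E' by blast
  qed (use B lt E E' in \<open>simp_all only: ext_sum\<close>)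
  have C: "\<forall>j<N. ext n b j = ext n' b' j"
  proof (rule digits_unique[where B = B and x = y])
    show "\<forall>j<N. \<bar>ext n b j\<bar> \<le> B - 1 \<and> sgn y * ext n b j \<ge> 0"
      using ext_bd[of n b y] E by blast
    show "\<forall>j<N. \<bar>ext n' b' j\<bar> \<le> B - 1 \<and> sgn y * ext n' b' j \<ge> 0"
      using ext_bd[of n' b' y] E' by blast
  qed (use B lt E E' in \<open>simp_all only: ext_sum\<close>)
  have "n \<le> n'"
    using A C lt E by (metis ext_def order_refl)
  moreover have "n' \<le> n"
    using A C lt E' by (metis ext_def order_refl)
  ultimately have nn: "n = n'" by simp
  have "a j = a' j \<and> b j = b' j" if "j \<le> n" for j
  proof -
    have "j < N" using that lt(1) by simp
    then have "ext n a j = ext n' a' j" "ext n b j = ext n' b' j" using A C by blast+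
    then show ?thesis using that nn by (simp add: ext_def)
  qed
  then show ?thesis using nn by blast
qed

lemma gauss_happy_fun_eq:
  assumes "B \<ge> 2" "z \<noteq> 0" "gauss_expansion B z n a b"
  shows "gauss_happy_fun B z = (\<Sum>j\<le>n. (of_int (a j) + of_int (b j) * \<i>)\<^sup>2)"
proof -
  have "(THE s. \<exists>n a b. gauss_expansion B z n a b \<and>
            s = (\<Sum>j\<le>n. (of_int (a j) + of_int (b j) * \<i>)\<^sup>2)) =
        (\<Sum>j\<le>n. (of_int (a j) + of_int (b j) * \<i>)\<^sup>2)"
  proof (rule the_equality)
    show "\<exists>n' a' b'. gauss_expansion B z n' a' b' \<and>
        (\<Sum>j\<le>n. (of_int (a j) + of_int (b j) * \<i>)\<^sup>2) =
        (\<Sum>j\<le>n'. (of_int (a' j) + of_int (b' j) * \<i>)\<^sup>2)"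
      using assms(3) by blast
  next
    fix s :: complex
    assume "\<exists>n' a' b'. gauss_expansion B z n' a' b' \<and>
        s = (\<Sum>j\<le>n'. (of_int (a' j) + of_int (b' j) * \<i>)\<^sup>2)"
    then obtain n' a' b' where e': "gauss_expansion B z n' a' b'"
      and s: "s = (\<Sum>j\<le>n'. (of_int (a' j) + of_int (b' j) * \<i>)\<^sup>2)" by blast
    have u: "n = n' \<and> (\<forall>j\<le>n. a j = a' j \<and> b j = b' j)"
      using gauss_expansion_unique[OF assms(1,3) e'] .
    show "s = (\<Sum>j\<le>n. (of_int (a j) + of_int (b j) * \<i>)\<^sup>2)"
      unfolding s using u by (intro sum.cong) auto
  qed
  then show ?thesis using assms(2) by (simp add: gauss_happy_fun_def)
qed

end

theory Submission
  imports Defs "HOL-Number_Theory.Cong"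
begin

text \<open>
  Write \<open>Q x\<close> for the sum of the squares of the base \<open>B\<close> digits of \<open>x\<close>. The problem reduces to
  rational integers: if \<open>X\<close> has only digits \<open>0\<close> and \<open>1\<close>, all in positions above those of \<open>k\<close>, then
  \<open>S (X + k (1 + i)) = Q X + 2 Q k i\<close>, since the real parts \<open>Q k - Q k\<close> cancel; and if the digits of
  \<open>Y\<close> lie above those of \<open>2 Q k\<close>, then \<open>S (Y + 2 Q k i) = Q Y - Q (2 Q k)\<close> is real. As \<open>Q X\<close> and
  \<open>Q Y\<close> can be prescribed, it suffices to translate the finite set of the \<open>- Q (2 Q k)\<close> into the
  happy numbers.

  For a finite set of naturals whose elements have the same parity if \<open>B\<close> is odd, this follows by
  induction on the cardinality: two elements \<open>s < t\<close> are identified by two applications of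
  translation followed by \<open>Q\<close>. The first makes the two values congruent modulo \<open>B - 1\<close>; for values
  \<open>u\<close> and \<open>u + (B - 1) w\<close> the second one translates \<open>u\<close> to \<open>w + B ^ L\<close> and therefore the other
  value to \<open>B w + B ^ L\<close>, which has the same nonzero digits.
\<close>

section \<open>Digit products and digit squares in base \<open>b\<close>\<close>

text \<open>The diagonal is \<open>Q\<close>; twice a mixed value is an imaginary part of
  \<open>S\<close>. The range \<open>j < x\<close> reaches every nonzero digit of \<open>x\<close>
  because \<open>x < b ^ x\<close> when \<open>b \<ge> 2\<close>.\<close>

definition digit_dot :: "nat \<Rightarrow> nat \<Rightarrow> nat \<Rightarrow> nat" where
  "digit_dot b x y = (\<Sum>j<x. (x div b ^ j mod b) * (y div b ^ j mod b))"

abbreviation digit_sq :: "nat \<Rightarrow> nat \<Rightarrow> nat" where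
  "digit_sq b x \<equiv> digit_dot b x x"

definition repunit :: "nat \<Rightarrow> nat \<Rightarrow> nat" where
  "repunit b n = (\<Sum>j<n. b ^ j)"

lemma sum_digits_mod:
  fixes b x :: nat
  shows "(\<Sum>j<N. (x div b ^ j mod b) * b ^ j) = x mod b ^ N"
proof (induction N)
  case (Suc N)
  have "x mod b ^ Suc N = b ^ N * (x div b ^ N mod b) + x mod b ^ N"
    using mod_mult2_eq[of x "b ^ N" b] by (simp add: mult.commute)
  then show ?case using Suc by (simp add: mult.commute)
qed simp

context
  fixes b :: nat
  assumes b: "b \<ge> 2"
begin

lemma less_base_power: "n < b ^ n"
  using b less_exp[of n] power_mono[of 2 b n] by linarith

lemma digit_dot_eq:
  assumes "x < b ^ N"
  shows "digit_dot b x y = (\<Sum>j<N. (x div b ^ j mod b) * (y div b ^ j mod b))"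
proof -
  have vanish: "x div b ^ j = 0" if "x < b ^ M" "M \<le> j" for M j
    using that b power_increasing[of M j b] by (intro div_less) linarith
  have "(\<Sum>j<M. (x div b ^ j mod b) * (y div b ^ j mod b)) =
      (\<Sum>j<max x N. (x div b ^ j mod b) * (y div b ^ j mod b))" if "x < b ^ M" "M \<le> max x N" for M
    using that vanish[of M] by (intro sum.mono_neutral_left) auto
  from this[of x] this[of N] show ?thesis
    using assms less_base_power[of x] by (simp add: digit_dot_def)
qed

text \<open>The low blocks end below position \<open>L\<close>, so no carry occurs and the digits of
  the two blocks sit side by side.\<close>

lemma digit_dot_add:
  assumes "x < b ^ L" "y < b ^ L"
  shows "digit_dot b (x + b ^ L * x') (y + b ^ L * y') = digit_dot b x y + digit_dot b x' y'"
proof -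
  obtain N where N: "x' < b ^ N" using less_base_power by blast
  have lt: "x + b ^ L * x' < b ^ (L + N)"
  proof -
    have "x + b ^ L * x' < b ^ L * (x' + 1)" using assms by simp
    also have "\<dots> \<le> b ^ L * b ^ N" using N by (intro mult_left_mono) auto
    finally show ?thesis by (simp add: power_add)
  qed
  have low: "(u + b ^ L * u') div b ^ j mod b = u div b ^ j mod b" if j: "j < L" for u u' j
  proof -
    obtain i where L: "L = Suc (j + i)" using less_imp_Suc_add[OF j] by blast
    have "u + b ^ L * u' = u + (b * (b ^ i * u')) * b ^ j"
      by (simp add: L power_add algebra_simps)
    then have "(u + b ^ L * u') div b ^ j = b * (b ^ i * u') + u div b ^ j"
      using b by (simp only:) simp
    then show ?thesis by simp
  qed
  have high: "(u + b ^ L * u') div b ^ (L + i) = u' div b ^ i" if "u < b ^ L" for u u' i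
    using that b by (simp add: power_add div_mult2_eq)
  have split: "(\<Sum>j<L + N. f j) = (\<Sum>j<L. f j) + (\<Sum>i<N. f (L + i))" for f :: "nat \<Rightarrow> nat"
    by (induction N) (auto simp: add.assoc)
  show ?thesis
    unfolding digit_dot_eq[OF lt] split digit_dot_eq[OF assms(1)] digit_dot_eq[OF N]
    using high assms by (simp add: low)
qed

lemma digit_dot_0_left [simp]: "digit_dot b 0 y = 0"
  by (simp add: digit_dot_def)

lemma digit_dot_0_right [simp]: "digit_dot b x 0 = 0"
  by (simp add: digit_dot_def)

lemma digit_dot_digits:
  assumes "x < b" "y < b"
  shows "digit_dot b x y = x * y"
  using assms digit_dot_eq[of x 1 y] by simp

lemma digit_sq_shift [simp]: "digit_sq b (b ^ L * x) = digit_sq b x"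
  using digit_dot_add[of 0 L 0 x x] b by simp

lemma digit_sq_base_power [simp]: "digit_sq b (b ^ L) = 1"
  using digit_sq_shift[of L 1] digit_dot_digits[of 1 1] b by simp

lemma digit_sq_repunit: "digit_sq b (repunit b n) = n"
proof (induction n)
  case (Suc n)
  have "repunit b (Suc n) = 1 + b ^ 1 * repunit b n"
    by (simp only: repunit_def sum.lessThan_Suc_shift sum_distrib_left power_Suc power_0) simp
  then show ?case
    using digit_dot_add[of 1 1 1 "repunit b n" "repunit b n"] digit_dot_digits[of 1 1] b Suc
    by simp
qed (simp add: repunit_def)

text \<open>Powers of an odd \<open>b\<close> are odd, so \<open>x\<close> has the parity of its
  digit sum, and each digit has the parity of its square.\<close>

lemma even_digit_sq_iff:
  assumes "odd b"
  shows "even (digit_sq b x) \<longleftrightarrow> even x"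
proof (induction x rule: less_induct)
  case (less x)
  show ?case
  proof (cases "x = 0")
    case False
    have x: "x = x mod b + b ^ 1 * (x div b)" by simp
    have m: "x mod b < b ^ 1" using b by simp
    have "digit_sq b x = (x mod b) * (x mod b) + digit_sq b (x div b)"
      using digit_dot_add[OF m m, of "x div b" "x div b"] digit_dot_digits[of "x mod b" "x mod b"] m
      by (simp flip: x)
    moreover have "even (digit_sq b (x div b)) \<longleftrightarrow> even (x div b)"
      using less[of "x div b"] False b by simp
    moreover have "even x \<longleftrightarrow> (even (x mod b) \<longleftrightarrow> even (x div b))"
      using assms by (subst x, unfold even_add even_mult_iff power_one_right) blast
    ultimately show ?thesis by simp
  qed simp
qed

section \<open>The happy function on the first quadrant\<close>

lemma gauss_happy_fun_digit_dot:
  assumes "x \<noteq> 0 \<or> y \<noteq> 0"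
  shows "gauss_happy_fun (int b) (Complex (real x) (real y)) =
    Complex (real (digit_sq b x) - real (digit_sq b y)) (2 * real (digit_dot b x y))"
proof -
  \<comment> \<open>The leading position of the longer of \<open>x\<close> and \<open>y\<close>;
    minimality yields the nonzero leading digit that the expansion requires.\<close>
  define n where "n = (LEAST n. x < b ^ Suc n \<and> y < b ^ Suc n)"
  have "x < b ^ Suc (x + y) \<and> y < b ^ Suc (x + y)"
    using less_base_power[of "Suc (x + y)"] by simp
  then have n: "x < b ^ Suc n" "y < b ^ Suc n"
    unfolding n_def by (metis (mono_tags, lifting) LeastI)+
  have "\<not> (x < b ^ n \<and> y < b ^ n)"
  proof (cases n)
    case (Suc k)
    then show ?thesis using not_less_Least[of k "\<lambda>n. x < b ^ Suc n \<and> y < b ^ Suc n"] n_def by auto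
  qed (use assms in auto)
  moreover have top: "u div b ^ n mod b \<noteq> 0" if "\<not> u < b ^ n" "u < b ^ Suc n" for u
  proof -
    have "u div b ^ n < b" using that(2) b by (simp add: less_mult_imp_div_less)
    moreover have "u div b ^ n \<noteq> 0" using that(1) b by (simp add: div_eq_0_iff)
    ultimately show ?thesis by simp
  qed
  ultimately have nz: "x div b ^ n mod b \<noteq> 0 \<or> y div b ^ n mod b \<noteq> 0" using n by blast
  define p where "p j = int (x div b ^ j mod b)" for j
  define q where "q j = int (y div b ^ j mod b)" for j
  have sums: "(\<Sum>j\<le>n. int (u div b ^ j mod b) * int b ^ j) = int u" if "u < b ^ Suc n" for u
  proof -
    have "(\<Sum>j<Suc n. (u div b ^ j mod b) * b ^ j) = u"
      using sum_digits_mod[of u b "Suc n"] that by simp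
    then show ?thesis
      unfolding lessThan_Suc_atMost
      by (metis (mono_tags, lifting) of_nat_mult of_nat_power of_nat_sum sum.cong)
  qed
  have bd: "\<bar>int (u mod b)\<bar> \<le> int b - 1" for u
    using mod_less_divisor[of b u] b by linarith
  have "gauss_expansion (int b) (Complex (of_int (int x)) (of_int (int y))) n p q"
    unfolding gauss_expansion_int_iff
    using nz sums n bd by (auto simp: p_def q_def sgn_if)
  then have "gauss_expansion (int b) (Complex (real x) (real y)) n p q" by simp
  then have "gauss_happy_fun (int b) (Complex (real x) (real y)) =
      (\<Sum>j\<le>n. (of_int (p j) + of_int (q j) * \<i>)\<^sup>2)"
    using assms b by (intro gauss_happy_fun_eq) (auto simp: complex_eq_iff)
  also have "\<dots> = (\<Sum>j\<le>n. of_int (p j * p j) - of_int (q j * q j) + \<i> * (2 * of_int (p j * q j)))"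
    by (intro sum.cong) (auto simp: power2_eq_square algebra_simps)
  also have "\<dots> = Complex (of_int (\<Sum>j\<le>n. p j * p j) - of_int (\<Sum>j\<le>n. q j * q j))
      (2 * of_int (\<Sum>j\<le>n. p j * q j))"
    by (simp add: complex_eq_iff sum_subtractf sum_distrib_left)
  also have "(\<Sum>j\<le>n. p j * p j) = int (digit_sq b x)"
    unfolding digit_dot_eq[OF n(1)] lessThan_Suc_atMost p_def of_nat_sum of_nat_mult ..
  also have "(\<Sum>j\<le>n. q j * q j) = int (digit_sq b y)"
    unfolding digit_dot_eq[OF n(2)] lessThan_Suc_atMost q_def of_nat_sum of_nat_mult ..
  also have "(\<Sum>j\<le>n. p j * q j) = int (digit_dot b x y)"
    unfolding digit_dot_eq[OF n(1)] lessThan_Suc_atMost p_def q_def of_nat_sum of_nat_mult ..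
  finally show ?thesis by simp
qed

lemma gauss_happy_step:
  assumes "z \<in> gauss_ints" "gauss_happy B (gauss_happy_fun B z)"
  shows "gauss_happy B z"
proof -
  obtain k where "(gauss_happy_fun B ^^ k) (gauss_happy_fun B z) = 1"
    using assms(2) unfolding gauss_happy_def by blast
  then have "(gauss_happy_fun B ^^ Suc k) z = 1" by (simp add: funpow_swap1)
  then show ?thesis using assms(1) unfolding gauss_happy_def by (metis le_add1 plus_1_eq_Suc)
qed

lemma gauss_happy_digit_dot:
  assumes "x \<noteq> 0 \<or> y \<noteq> 0"
    and "gauss_happy (int b)
      (Complex (real (digit_sq b x) - real (digit_sq b y)) (2 * real (digit_dot b x y)))"
  shows "gauss_happy (int b) (Complex (real x) (real y))"
  by (rule gauss_happy_step)
    (use assms in \<open>simp_all add: gauss_happy_fun_digit_dot gauss_ints_def\<close>)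

lemma gauss_happy_of_digit_sq:
  assumes "x \<noteq> 0" "gauss_happy (int b) (of_nat (digit_sq b x))"
  shows "gauss_happy (int b) (of_nat x)"
proof -
  have "of_nat u = Complex (real u) 0" for u by (simp add: complex_eq_iff)
  then show ?thesis using gauss_happy_digit_dot[of x 0] assms by simp
qed

lemma gauss_happy_base_power: "gauss_happy (int b) (of_nat (b ^ L))"
proof -
  have "gauss_happy_fun (int b) 1 = 1"
    using gauss_happy_fun_digit_dot[of 1 0] digit_dot_digits[of 1 1] b by (simp flip: one_complex.code)
  then have "gauss_happy (int b) 1"
    unfolding gauss_happy_def gauss_ints_def by (auto intro: exI[of _ 1])
  then show ?thesis
    using gauss_happy_of_digit_sq[of "b ^ L"] b by (simp del: of_nat_power)
qed

section \<open>Translating finite sets into the happy numbers\<close>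

text \<open>Arbitrarily large \<open>n\<close> are demanded so that a positive one can be chosen,
  which makes the repunit with that many ones nonzero.\<close>

definition translates_to_happy :: "nat set \<Rightarrow> bool" where
  "translates_to_happy T \<longleftrightarrow> (\<forall>M. \<exists>n\<ge>M. \<forall>t\<in>T. gauss_happy (int b) (of_nat (t + n)))"

text \<open>Placing \<open>n'\<close> ones above the digits of every \<open>t + n\<close> raises all
  the values of \<open>Q\<close> by exactly \<open>n'\<close> at once.\<close>

lemma translates_to_happy_preimage:
  assumes "finite T" "translates_to_happy ((\<lambda>t. digit_sq b (t + n)) ` T)"
  shows "translates_to_happy T"
  unfolding translates_to_happy_def
proof
  fix M
  obtain n' where n': "n' \<ge> 1"
    "\<And>t. t \<in> T \<Longrightarrow> gauss_happy (int b) (of_nat (digit_sq b (t + n) + n'))"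
    using assms(2) unfolding translates_to_happy_def by fast
  define L where "L = M + (\<Sum>t\<in>T. t + n)"
  have rep: "repunit b n' \<noteq> 0"
  proof
    assume "repunit b n' = 0"
    then show False using digit_sq_repunit[of n'] n'(1) by simp
  qed
  have big: "b ^ L \<le> b ^ L * repunit b n'" using rep by simp
  have "gauss_happy (int b) (of_nat (t + (n + b ^ L * repunit b n')))" if "t \<in> T" for t
  proof (rule gauss_happy_of_digit_sq)
    have "t + n \<le> (\<Sum>t\<in>T. t + n)"
      by (rule member_le_sum[of t T "\<lambda>t. t + n"]) (use that assms(1) in auto)
    then have "t + n \<le> L" unfolding L_def by (rule trans_le_add2)
    then have lt: "t + n < b ^ L" using less_base_power[of L] by (rule le_less_trans)
    have "digit_sq b (t + (n + b ^ L * repunit b n')) = digit_sq b (t + n) + n'"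
      unfolding add.assoc[symmetric] digit_dot_add[OF lt lt] digit_sq_repunit ..
    then show "gauss_happy (int b) (of_nat (digit_sq b (t + (n + b ^ L * repunit b n'))))"
      using n'(2)[OF that] by simp
    show "t + (n + b ^ L * repunit b n') \<noteq> 0" using rep b by simp
  qed
  moreover have "n + b ^ L * repunit b n' \<ge> M"
  proof -
    have "M \<le> L" unfolding L_def by (rule le_add1)
    then show ?thesis using big less_base_power[of L] by linarith
  qed
  ultimately show "\<exists>n\<ge>M. \<forall>t\<in>T. gauss_happy (int b) (of_nat (t + n))" by blast
qed

lemma ex_digit_sq_eq:
  assumes "[u = v] (mod (b - 1))"
  shows "\<exists>n. digit_sq b (u + n) = digit_sq b (v + n)"
  using assms
proof (induction u v rule: linorder_wlog)
  case (le u v)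
  then obtain w where w: "v = u + (b - 1) * w"
    by (metis cong_sym cong_le_nat mult.commute add.commute)
  \<comment> \<open>The digit 1 at position \<open>L\<close> keeps \<open>w + b ^ L - u\<close> from
    truncating; it lies above \<open>w\<close> and \<open>b * w\<close> and adds 1 to both values of
    \<open>Q\<close>.\<close>
  define L where "L = u + b * w"
  have L: "u + b * w < b ^ L" unfolding L_def by (rule less_base_power)
  have "w \<le> b * w" using b by simp
  then have lt: "w < b ^ L" "b * w < b ^ L" using L by linarith+
  have bw: "(b - 1) * w + w = b * w" using b by (cases b) auto
  have "u + (w + b ^ L - u) = w + b ^ L * 1" using L by simp
  moreover have "v + (w + b ^ L - u) = b * w + b ^ L * 1" using L w bw by simp
  moreover have "digit_sq b (b * w) = digit_sq b w" using digit_sq_shift[of 1 w] by simp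
  ultimately show ?case
    using digit_dot_add[OF lt(1) lt(1), of 1 1] digit_dot_add[OF lt(2) lt(2), of 1 1]
    by (intro exI[of _ "w + b ^ L - u"]) (simp only:)
next
  case (sym u v)
  then show ?case by (metis cong_sym)
qed

text \<open>For even \<open>b\<close>, 2 is invertible modulo \<open>b - 1\<close>; for odd
  \<open>b\<close>, \<open>q\<close> itself has the form \<open>2 * a + 1\<close>. The bound makes
  both \<open>a\<close> and \<open>a + 1\<close> digits.\<close>

lemma ex_odd_cong:
  assumes "odd b \<Longrightarrow> odd q"
  shows "\<exists>a<b - 1. [2 * a + 1 = q] (mod (b - 1))"
proof -
  have "\<exists>a. [2 * a + 1 = q] (mod (b - 1))"
  proof (cases "odd b")
    case True
    then show ?thesis using assms by (metis cong_refl oddE)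
  next
    case False
    then obtain c where c: "b = 2 * c" using evenE by blast
    \<comment> \<open>\<open>c\<close> is the inverse of \<open>2\<close>, and \<open>q + (b - 2)\<close> stands for \<open>q - 1\<close>.\<close>
    have "2 * (c * (q + (b - 2))) + 1 = q + (b - 1) * (q + (b - 2) + 1)"
      using b c by (cases c) (auto simp: algebra_simps)
    then show ?thesis by (metis cong_def mod_mult_self2)
  qed
  then obtain a where "[2 * a + 1 = q] (mod (b - 1))" by blast
  moreover have "[2 * (a mod (b - 1)) + 1 = 2 * a + 1] (mod (b - 1))"
    by (intro cong_add cong_mult) (simp_all add: cong_def)
  ultimately have "[2 * (a mod (b - 1)) + 1 = q] (mod (b - 1))" using cong_trans by blast
  moreover have "a mod (b - 1) < b - 1" using b by simp
  ultimately show ?thesis by blast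
qed

text \<open>Translate \<open>t\<close> to \<open>(a + 1) * b ^ t\<close>. Then \<open>s\<close>
  lands \<open>t - s\<close> lower, with digit \<open>a\<close> above a low block independent of
  \<open>a\<close>, whose \<open>Q\<close> is \<open>q\<close>. Comparing
  \<open>(a + 1) * (a + 1)\<close> with \<open>q + a * a\<close> leaves \<open>2 * a + 1\<close> to
  be matched with \<open>q\<close>.\<close>

lemma ex_digit_sq_cong:
  assumes "s < t" "odd b \<Longrightarrow> even s \<longleftrightarrow> even t"
  shows "\<exists>n. [digit_sq b (s + n) = digit_sq b (t + n)] (mod (b - 1))"
proof -
  define q where "q = digit_sq b (b ^ t - (t - s))"
  have t: "t < b ^ t" by (rule less_base_power)
  \<comment> \<open>Here \<open>b ^ t\<close> is odd, \<open>t - s\<close> is even, and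
    \<open>Q\<close> preserves parity.\<close>
  have "odd q" if "odd b"
    using that assms t by (simp add: q_def even_digit_sq_iff)
  then obtain a where a: "a < b - 1" "[2 * a + 1 = q] (mod (b - 1))"
    using ex_odd_cong by blast
  define n where "n = b ^ t * (a + 1) - t"
  have le: "t \<le> b ^ t * (a + 1)" using t by (simp add: trans_le_add1)
  have tn: "t + n = b ^ t * (a + 1)" using le by (simp add: n_def)
  have sn: "s + n = (b ^ t - (t - s)) + b ^ t * a"
    using tn t assms(1) by simp
  have lt: "b ^ t - (t - s) < b ^ t" using assms(1) t by simp
  have "digit_sq b (t + n) = (a + 1) * (a + 1)"
    unfolding tn digit_sq_shift using a(1) by (intro digit_dot_digits) auto
  moreover have "digit_sq b (s + n) = q + a * a"
    unfolding sn digit_dot_add[OF lt lt] q_def using a(1) by (simp add: digit_dot_digits)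
  moreover have "[q + a * a = (2 * a + 1) + a * a] (mod (b - 1))"
    using a(2) by (intro cong_add) (auto simp: cong_sym)
  moreover have "(a + 1) * (a + 1) = (2 * a + 1) + a * a" by simp
  ultimately show ?thesis by metis
qed

lemma translates_to_happy_finite:
  assumes "finite T" "T \<noteq> {}" "odd b \<Longrightarrow> \<forall>s\<in>T. \<forall>t\<in>T. even s \<longleftrightarrow> even t"
  shows "translates_to_happy T"
  using assms
proof (induction "card T" arbitrary: T rule: less_induct)
  case less
  show ?case
  proof (cases "\<exists>s\<in>T. \<exists>t\<in>T. s < t")
    case True
    then obtain s t where st: "s \<in> T" "t \<in> T" "s < t" by blast
    obtain n where n: "[digit_sq b (s + n) = digit_sq b (t + n)] (mod (b - 1))"
      using ex_digit_sq_cong[OF st(3)] less.prems(3) st by blast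
    obtain n' where n': "digit_sq b (digit_sq b (s + n) + n') = digit_sq b (digit_sq b (t + n) + n')"
      using ex_digit_sq_eq[OF n] by blast
    define U where "U = (\<lambda>t. digit_sq b (t + n)) ` T"
    define V where "V = (\<lambda>u. digit_sq b (u + n')) ` U"
    have "V = (\<lambda>t. digit_sq b (digit_sq b (t + n) + n')) ` T"
      by (simp add: U_def V_def image_image)
    moreover have "\<not> inj_on (\<lambda>t. digit_sq b (digit_sq b (t + n) + n')) T"
      using n' st by (auto dest: inj_onD)
    ultimately have "card V < card T"
      using less.prems(1) by (simp add: inj_on_iff_eq_card card_image_le le_neq_implies_less)
    then have "translates_to_happy V"
    proof (rule less.hyps)
      assume odd: "odd b"
      show "\<forall>s\<in>V. \<forall>t\<in>V. even s \<longleftrightarrow> even t"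
        unfolding V_def U_def ball_simps even_digit_sq_iff[OF odd] even_add
        using less.prems(3)[OF odd] by blast
    qed (simp_all add: U_def V_def less.prems(1,2))
    then have "translates_to_happy U"
      unfolding V_def
      by (rule translates_to_happy_preimage[rotated]) (simp add: U_def less.prems(1))
    then show ?thesis
      unfolding U_def by (rule translates_to_happy_preimage[OF less.prems(1)])
  next
    case False
    \<comment> \<open>A singleton is translated onto a power of \<open>b\<close>, which is happy
      since its \<open>Q\<close> is 1.\<close>
    obtain t where "t \<in> T" using less.prems(2) by blast
    with False have T: "T = {t}" by (auto simp: not_less antisym)
    show ?thesis
      unfolding translates_to_happy_def T
    proof
      fix M
      have eq: "t + (b ^ (M + t) - t) = b ^ (M + t)" and ge: "b ^ (M + t) - t \<ge> M"
        using less_base_power[of "M + t"] by linarith+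
      show "\<exists>n\<ge>M. \<forall>t\<in>{t}. gauss_happy (int b) (of_nat (t + n))"
        using gauss_happy_base_power[of "M + t"]
        by (intro exI[of _ "b ^ (M + t) - t"]) (simp only: eq ge ball_simps simp_thms)
    qed
  qed
qed

section \<open>Consecutive Gaussian happy numbers\<close>

lemma ex_consecutive_gauss_happy:
  "\<exists>x. \<forall>k<m. gauss_happy (int b) (Complex (real (x + k)) (real k))"
proof (cases "m = 0")
  case False
  define q where "q k = digit_sq b (2 * digit_sq b k)" for k
  \<comment> \<open>One bound for three uses: \<open>k\<close> and \<open>2 * digit_sq b k\<close>
    fit below \<open>b ^ K\<close>, and \<open>2 * K - q k\<close> does not truncate.\<close>
  define K where "K = (\<Sum>k<m. k + 2 * digit_sq b k + q k)"
  have K: "k + 2 * digit_sq b k + q k \<le> K" if "k < m" for k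
    unfolding K_def
    using that member_le_sum[of k "{..<m}" "\<lambda>k. k + 2 * digit_sq b k + q k"] by simp
  \<comment> \<open>The shift moves the \<open>- q k\<close> into the naturals; it is even so that
    for odd \<open>b\<close> all elements are even, as each \<open>q k\<close> is.\<close>
  have "translates_to_happy ((\<lambda>k. 2 * K - q k) ` {..<m})"
  proof (rule translates_to_happy_finite)
    assume "odd b"
    then have "even (q k)" for k by (simp add: q_def even_digit_sq_iff)
    then have "even (2 * K - q k)" for k by simp
    then show "\<forall>s\<in>(\<lambda>k. 2 * K - q k) ` {..<m}. \<forall>t\<in>(\<lambda>k. 2 * K - q k) ` {..<m}. even s \<longleftrightarrow> even t"
      by blast
  qed (use False in auto)
  then obtain n where n: "n \<ge> 1" "\<And>k. k < m \<Longrightarrow> gauss_happy (int b) (of_nat (2 * K - q k + n))"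
    unfolding translates_to_happy_def by fast
  \<comment> \<open>Chosen backwards: the first application of \<open>S\<close> must yield real part
    \<open>y\<close>, the second the happy number \<open>2 * K - q k + n\<close>.\<close>
  define y where "y = b ^ K * repunit b (2 * K + n)"
  define x where "x = b ^ K * repunit b y"
  have sq: "digit_sq b y = 2 * K + n" "digit_sq b x = y"
    by (simp_all add: x_def y_def digit_sq_repunit)
  have "y \<noteq> 0"
  proof
    assume "y = 0"
    then show False using sq(1) n(1) by simp
  qed
  moreover have "x \<noteq> 0"
  proof
    assume "x = 0"
    then show False using sq(2) \<open>y \<noteq> 0\<close> by simp
  qed
  ultimately have nz: "y \<noteq> 0" "x \<noteq> 0" by blast+
  have "gauss_happy (int b) (Complex (real (x + k)) (real k))" if k: "k < m" for k
  proof -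
    have lt: "k < b ^ K" "2 * digit_sq b k < b ^ K"
      using K[OF k] less_base_power[of K] by linarith+
    have sx: "digit_sq b (x + k) = digit_sq b k + y" "digit_dot b (x + k) k = digit_sq b k"
      using digit_dot_add[OF lt(1) lt(1), of "repunit b y" "repunit b y"]
        digit_dot_add[OF lt(1) lt(1), of "repunit b y" 0]
      by (simp_all add: x_def digit_sq_repunit add.commute)
    \<comment> \<open>Disjoint digit positions make the second imaginary part vanish.\<close>
    have sy: "digit_dot b y (2 * digit_sq b k) = 0"
      using digit_dot_add[of 0 K "2 * digit_sq b k" "repunit b (2 * K + n)" 0] lt b
      by (simp add: y_def)
    have "Complex (real (digit_sq b y) - real (q k)) 0 = of_nat (2 * K - q k + n)"
      using K[OF k] sq by (simp add: complex_eq_iff of_nat_diff)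
    then have "gauss_happy (int b) (Complex (real y) (real (2 * digit_sq b k)))"
      using nz n(2)[OF k] sy by (intro gauss_happy_digit_dot) (auto simp: q_def)
    then show ?thesis
      using nz sx by (intro gauss_happy_digit_dot) auto
  qed
  then show ?thesis by blast
qed simp

end

theorem theorem16:
  fixes B :: int and D :: complex and m :: nat
  assumes "B \<ge> 2" and "D = 1 + \<i>" and "m > 0"
  shows "\<exists>zs. consecutive_seq D m zs \<and> (\<forall>z\<in>set zs. gauss_happy B z)"
proof -
  have "nat B \<ge> 2" and B: "int (nat B) = B" using assms(1) by auto
  then obtain x where x: "\<forall>k<m. gauss_happy B (Complex (real (x + k)) (real k))"
    using ex_consecutive_gauss_happy[of "nat B" m] unfolding B by blast
  define zs where "zs = map (\<lambda>k. of_nat x + of_nat k * D) [0..<m]"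
  have "of_nat x + of_nat k * D = Complex (real (x + k)) (real k)" for k
    by (simp add: assms(2) complex_eq_iff)
  then have "\<forall>z\<in>set zs. gauss_happy B z" using x by (auto simp: zs_def)
  moreover have "consecutive_seq D m zs"
  proof -
    have "D \<in> gauss_ints" "D \<noteq> 0" "of_nat x \<in> gauss_ints"
      by (simp_all add: assms(2) gauss_ints_def complex_eq_iff)
    then show ?thesis unfolding consecutive_seq_def zs_def by blast
  qed
  ultimately show ?thesis by blast
qed

end
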